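(* Let $n\in\mathbb{N}_0$, $j\in\mathbb{N}$, $k\in\mathbb{N}_0$, $a,b\in\mathbb{R}^+$, $\beta\in\mathbb{C}\setminus\{0\}$, excluding the case where $k=0$ and $\beta^b=a^b$. If $a\neq\beta$, then $$\left\langle(\beta^b e^t-a^b)^j\mid\mathcal{Y}_{n,\beta}(x;k,a,b)\right\rangle=\frac{\beta^{b(j-1)}k!}{2^{k-1}}\binom{n}{k}\sum_{l=0}^{j-1}\frac{(j-1)!}{(j-l-1)!}\left(1-\frac{a^b}{\beta^b}\right)^{j-l-1}S(n-k,l).$$ If $a=\beta$, then $$\left\langle(e^t-1)^j\mid\mathcal{Y}_{n,a}(x;k,a,b)\right\rangle=\frac{k!\,(j-1)!}{2^{k-1}a^b}\binom{n}{k}S(n-k,j-1).$$ Here $S(u,v)$ denotes the Stirling numbers of the second kind.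
   Context: $\mathbb{N}=\{1,2,\dots\}$, $\mathbb{N}_0=\mathbb{N}\cup\{0\}$. Complex powers: $\beta^b=\exp(b\ln\beta)$ with the principal branch of $\ln$. The polynomials $\mathcal{Y}_{n,\beta}(x;k,a,b)$ are defined by the expansion in powers of $t$ $$\frac{2^{1-k}t^k}{\beta^b e^t-a^b}\,e^{xt}=\sum_{n=0}^\infty\mathcal{Y}_{n,\beta}(x;k,a,b)\frac{t^n}{n!}.$$ A formal power series $u(t)=\sum_{i\ge0}\frac{c_i}{i!}t^i$ acts as a linear functional on polynomials in $x$ by $\langle u(t)\mid x^n\rangle=c_n$; in particular $\langle e^{yt}\mid p(x)\rangle=p(y)$. Conventions: $0^0=1$; for $n<k$, $\binom{n}{k}=0$ and the right-hand sides are $0$. *)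

theory Defs
  imports "HOL-Analysis.Analysis" "HOL-Computational_Algebra.Computational_Algebra"
    "HOL-Combinatorics.Stirling"
begin

unbundle fps_syntax

definition umbral :: "complex fps \<Rightarrow> complex poly \<Rightarrow> complex" where
  "umbral u p = (\<Sum>i\<le>degree p. coeff p i * (fact i * u $ i))"

lemma umbral_eq_sum:
  assumes "degree p \<le> N"
  shows "umbral u p = (\<Sum>i\<le>N. coeff p i * (fact i * u $ i))"
  unfolding umbral_def
  by (rule sum.mono_neutral_left) (use assms in \<open>auto simp: coeff_eq_0\<close>)

lemma umbral_monom_1: "umbral (Abs_fps (\<lambda>i. c i / fact i)) (monom 1 n) = c n"
proof -
  have "umbral (Abs_fps (\<lambda>i. c i / fact i)) (monom 1 n) = (\<Sum>i\<le>n. coeff (monom 1 n) i * c i)"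
    by (simp add: umbral_def degree_monom_eq)
  also have "\<dots> = (\<Sum>i\<le>n. if i = n then c i else 0)"
    by (rule sum.cong) auto
  finally show ?thesis by simp
qed

lemma umbral_add: "umbral u (p + q) = umbral u p + umbral u q"
proof -
  let ?N = "max (degree p) (degree q)"
  show ?thesis
    by (simp add: umbral_eq_sum[where N = ?N] degree_add_le_max sum.distrib algebra_simps)
qed

lemma umbral_smult: "umbral u (smult c p) = c * umbral u p"
  by (simp add: umbral_eq_sum[where N = "degree p"] sum_distrib_left mult.assoc)

lemma umbral_fps_exp: "umbral (fps_exp y) p = poly p y"
  by (simp add: umbral_def poly_altdef)

(* Division of formal power series cancels the common power of t first, so the quotient
   t^k / (beta^b e^t - a^b) is the intended series even if the denominator has no constant term,
   except when k = 0 and beta^b = a^b (see Ypoly_genfun). *)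
definition Y_coeff_fps :: "complex \<Rightarrow> nat \<Rightarrow> real \<Rightarrow> real \<Rightarrow> complex fps" where
  "Y_coeff_fps \<beta> k a b =
     fps_const (2 powi (1 - int k)) * fps_X ^ k /
       (fps_const (\<beta> powr of_real b) * fps_exp 1 - fps_const (of_real (a powr b)))"

(* The series e^(x t) in t, with coefficients in the polynomials in x. *)
definition exp_xt :: "complex poly fps" where
  "exp_xt = Abs_fps (\<lambda>n. monom (1 / fact n) n)"

definition Ypoly :: "nat \<Rightarrow> complex \<Rightarrow> nat \<Rightarrow> real \<Rightarrow> real \<Rightarrow> complex poly" where
  "Ypoly n \<beta> k a b =
     smult (fact n) ((Abs_fps (\<lambda>i. [:Y_coeff_fps \<beta> k a b $ i:]) * exp_xt) $ n)"

lemma Ypoly_genfun: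
  assumes "\<beta> \<noteq> 0" and "\<not> (k = 0 \<and> \<beta> powr of_real b = of_real (a powr b))"
  shows "(fps_const (\<beta> powr of_real b) * fps_exp 1 - fps_const (of_real (a powr b))) *
           Abs_fps (\<lambda>n. poly (Ypoly n \<beta> k a b) x / fact n) =
         fps_const (2 powi (1 - int k)) * fps_X ^ k * fps_exp x"
proof -
  let ?D = "fps_const (\<beta> powr of_real b) * fps_exp 1 - fps_const (of_real (a powr b))"
  have D1: "?D $ 1 \<noteq> 0" using assms(1) by simp
  have D0: "k = 0 \<Longrightarrow> ?D $ 0 \<noteq> 0" using assms(2) by simp
  have "subdegree ?D \<le> k"
  proof (cases "k = 0")
    case True then show ?thesis using subdegree_leI[OF D0] by simp
  next
    case False then show ?thesis using subdegree_leI[OF D1] by simp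
  qed
  moreover have "subdegree (fps_const (2 powi (1 - int k) :: complex) * fps_X ^ k) = k"
    by (simp add: fps_X_power_subdegree)
  moreover have "?D \<noteq> 0" using D1 by (metis fps_zero_nth)
  ultimately have dvd: "?D dvd fps_const (2 powi (1 - int k)) * fps_X ^ k"
    by (subst fps_dvd_iff) auto
  have "Abs_fps (\<lambda>n. poly (Ypoly n \<beta> k a b) x / fact n) = Y_coeff_fps \<beta> k a b * fps_exp x"
    by (rule fps_ext)
      (simp add: Ypoly_def exp_xt_def fps_mult_nth poly_sum poly_monom field_simps)
  moreover have "?D * Y_coeff_fps \<beta> k a b = fps_const (2 powi (1 - int k)) * fps_X ^ k"
    unfolding Y_coeff_fps_def using dvd by (rule dvd_mult_div_cancel)
  ultimately show ?thesis by (simp add: mult.assoc [symmetric])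
qed

end

theory Submission
  imports Defs
begin

text \<open>
  On an Appell sequence with generating function \<open>Y(t) e\<^sup>x\<^sup>t\<close> the umbral functional
  satisfies \<open>\<langle>u | Y\<^sub>n\<rangle> = n! [t\<^sup>n] u(t) Y(t)\<close>. For \<open>D = \<beta>\<^sup>b e\<^sup>t - a\<^sup>b\<close> and \<open>D Y = 2\<^sup>1\<^sup>-\<^sup>k t\<^sup>k\<close> this
  reduces everything to the coefficient of \<open>t\<^sup>n\<^sup>-\<^sup>k\<close> in a power of \<open>D\<close>, which is expanded
  binomially in powers of \<open>e\<^sup>t - 1\<close>, the generating functions of the Stirling numbers.
\<close>

text \<open>Since e^t = (e^t - 1) + 1, differentiating (e^t - 1)^(m+1) gives (m+1) times the sum of
  the powers m+1 and m. Comparing coefficients yields the Stirling recurrence.\<close>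

lemma fps_exp_minus_one_power_nth:
  "((fps_exp 1 - 1) ^ l) $ n = (fact l * of_nat (Stirling n l) / fact n :: 'a::field_char_0)"
proof (induction n arbitrary: l)
  case 0
  show ?case by (cases l) (simp_all add: fps_power_zeroth)
next
  case (Suc n)
  show ?case
  proof (cases l)
    case 0
    then show ?thesis by simp
  next
    case (Suc m)
    let ?E = "fps_exp 1 - 1 :: 'a fps"
    have "?E ^ Suc m + ?E ^ m = fps_exp 1 * ?E ^ m"
      by (simp add: algebra_simps)
    then have "fps_deriv (?E ^ Suc m) = of_nat (Suc m) * (?E ^ Suc m + ?E ^ m)"
      by (simp only: fps_deriv_power)
        (simp add: fps_of_nat mult_ac del: of_nat_Suc power_Suc)
    then have "fps_deriv (?E ^ Suc m) $ n = of_nat (Suc m) * (?E ^ Suc m $ n + ?E ^ m $ n)"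
      by (simp add: fps_of_nat [symmetric] del: of_nat_Suc power_Suc)
    then have "of_nat (Suc n) * (?E ^ Suc m $ Suc n) =
        of_nat (Suc m) * (fact (Suc m) * of_nat (Stirling n (Suc m)) / fact n +
          fact m * of_nat (Stirling n m) / fact n)"
      by (simp only: Suc.IH fps_deriv_nth Suc_eq_plus1)
    also have "\<dots> = fact (Suc m) * of_nat (Stirling (Suc n) (Suc m)) / fact n"
      by (simp add: algebra_simps add_divide_distrib)
    also have "\<dots> = of_nat (Suc n) *
        (fact (Suc m) * of_nat (Stirling (Suc n) (Suc m)) / fact (Suc n))"
      by (subst fact_Suc [of n]) (simp del: of_nat_Suc)
    finally show ?thesis
      using Suc by (simp only: mult_cancel_left of_nat_eq_0_iff) simp
  qed
qed

text \<open>Factor the base as B ((e^t - 1) + (1 - A/B)) and expand binomially. The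
  \<open>fact l\<close> from the Stirling generating function turns \<open>m choose l\<close> into
  m!/(m-l)!.\<close>

lemma fps_mult_exp_diff_power_nth:
  fixes A B :: "'a::field_char_0"
  assumes "B \<noteq> 0"
  shows "((fps_const B * fps_exp 1 - fps_const A) ^ m) $ n =
    B ^ m * (\<Sum>l=0..m. fact m / fact (m - l) * (1 - A / B) ^ (m - l) * of_nat (Stirling n l))
      / fact n"
proof -
  let ?E = "fps_exp 1 - 1 :: 'a fps"
  have "fps_const B * fps_exp 1 - fps_const A = fps_const B * (?E + fps_const (1 - A / B))"
    by (rule fps_ext) (use assms in \<open>simp add: field_simps\<close>)
  then have "(fps_const B * fps_exp 1 - fps_const A) ^ m =
      fps_const (B ^ m) * (\<Sum>l\<le>m. of_nat (m choose l) * ?E ^ l * fps_const (1 - A / B) ^ (m - l))"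
    by (simp add: power_mult_distrib fps_const_power binomial_ring)
  also have "\<dots> $ n = B ^ m *
      (\<Sum>l\<le>m. of_nat (m choose l) * (fact l * of_nat (Stirling n l) / fact n) * (1 - A / B) ^ (m - l))"
    by (simp add: fps_sum_nth fps_const_power fps_of_nat [symmetric] fps_exp_minus_one_power_nth)
  also have "\<dots> = B ^ m * (\<Sum>l\<le>m. fact m / fact (m - l) * (1 - A / B) ^ (m - l)
      * of_nat (Stirling n l) / fact n)"
    by (intro arg_cong2 [of _ _ _ _ "(*)"] refl sum.cong) (simp add: binomial_fact)
  finally show ?thesis
    unfolding sum_divide_distrib [symmetric] by (simp add: atLeast0AtMost)
qed

lemma coeff_Ypoly:
  "coeff (Ypoly n \<beta> k a b) i =
    (if i \<le> n then fact n * Y_coeff_fps \<beta> k a b $ (n - i) / fact i else 0)"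
proof -
  let ?Y = "Y_coeff_fps \<beta> k a b"
  have "coeff (Ypoly n \<beta> k a b) i =
      fact n * (\<Sum>m=0..n. if n - m = i then ?Y $ m / fact i else 0)"
    by (auto simp: Ypoly_def exp_xt_def fps_mult_nth coeff_sum intro!: sum.cong)
  \<comment> \<open>The inner test \<open>i \<le> n\<close> is essential: for i > n truncated
    subtraction gives n - i = 0, which would wrongly select m = 0.\<close>
  also have "(\<Sum>m=0..n. if n - m = i then ?Y $ m / fact i else 0) =
      (\<Sum>m=0..n. if m = n - i then if i \<le> n then ?Y $ (n - i) / fact i else 0 else 0)"
    by (intro sum.cong) auto
  finally show ?thesis by simp
qed

text \<open>The factor i! in the functional cancels the 1/i! in the coefficient of x^i, leaving a
  Cauchy product.\<close>

lemma umbral_Ypoly: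
  "umbral u (Ypoly n \<beta> k a b) = fact n * (u * Y_coeff_fps \<beta> k a b) $ n"
proof -
  have "degree (Ypoly n \<beta> k a b) \<le> n"
    by (rule degree_le) (simp add: coeff_Ypoly)
  then show ?thesis
    by (simp add: umbral_eq_sum [where N = n] coeff_Ypoly fps_mult_nth sum_distrib_left
        atLeast0AtMost mult_ac)
qed

text \<open>At x = 0 the factor e^(xt) is 1, so the generating function reduces to
  \<open>Y_coeff_fps\<close> itself.\<close>

lemma mult_Y_coeff_fps:
  assumes "\<beta> \<noteq> 0" and "\<not> (k = 0 \<and> \<beta> powr of_real b = of_real (a powr b))"
  shows "(fps_const (\<beta> powr of_real b) * fps_exp 1 - fps_const (of_real (a powr b))) *
    Y_coeff_fps \<beta> k a b = fps_const (2 powi (1 - int k)) * fps_X ^ k"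
proof -
  have "Abs_fps (\<lambda>n. poly (Ypoly n \<beta> k a b) 0 / fact n) = Y_coeff_fps \<beta> k a b"
    by (rule fps_ext) (simp add: poly_0_coeff_0 coeff_Ypoly)
  then show ?thesis
    using Ypoly_genfun [OF assms, of 0] by simp
qed

text \<open>For k \<le> n this is n! = k! (n choose k) (n-k)!. For n < k both sides vanish, so the
  truncated n - k does no harm.\<close>

lemma fact_mult_fps_X_power_nth:
  fixes f :: "'a::field_char_0 fps"
  shows "fact n * (f * (fps_const c * fps_X ^ k)) $ n =
    c * fact k * of_nat (n choose k) * (fact (n - k) * f $ (n - k))"
proof -
  have "(f * (fps_const c * fps_X ^ k)) $ n = c * (if n < k then 0 else f $ (n - k))"
    by (simp add: mult.left_commute [of f] fps_X_power_mult_right_nth)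
  then show ?thesis
    by (simp add: binomial_fact)
qed

theorem theorem3:
  fixes n j k :: nat and a b :: real and \<beta> :: complex
  assumes "j \<ge> 1" and "a > 0" and "b > 0" and "\<beta> \<noteq> 0"
    and "\<not> (k = 0 \<and> \<beta> powr of_real b = of_real (a powr b))"
  shows "(of_real a \<noteq> \<beta> \<longrightarrow>
      umbral ((fps_const (\<beta> powr of_real b) * fps_exp 1 - fps_const (of_real (a powr b))) ^ j)
        (Ypoly n \<beta> k a b) =
      \<beta> powr (of_real b * (of_nat j - 1)) * fact k / 2 powi (int k - 1) * of_nat (n choose k) *
        (\<Sum>l = 0..j - 1. fact (j - 1) / fact (j - l - 1) *
          (1 - of_real (a powr b) / \<beta> powr of_real b) ^ (j - l - 1) *
          of_nat (Stirling (n - k) l))) \<and>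
    (of_real a = \<beta> \<longrightarrow>
      umbral ((fps_exp 1 - 1) ^ j) (Ypoly n (of_real a) k a b) =
      fact k * fact (j - 1) / (2 powi (int k - 1) * of_real (a powr b)) *
        of_nat (n choose k) * of_nat (Stirling (n - k) (j - 1)))"
proof -
  define A :: complex where "A = of_real (a powr b)"
  define B where "B = \<beta> powr of_real b"
  define D where "D = fps_const B * fps_exp 1 - fps_const A"
  define Y where "Y = Y_coeff_fps \<beta> k a b"
  define c :: complex where "c = 2 powi (1 - int k)"
  obtain m where j: "j = Suc m"
    using \<open>j \<ge> 1\<close> by (cases j) auto
  have A: "A \<noteq> 0" and B: "B \<noteq> 0"
    using assms by (auto simp: A_def B_def)
  have c: "c = 1 / 2 powi (int k - 1)"
    unfolding c_def by (simp add: field_simps flip: power_int_minus_divide power_int_add)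
  have DY: "D * Y = fps_const c * fps_X ^ k"
    unfolding D_def Y_def A_def B_def c_def by (rule mult_Y_coeff_fps) (use assms in auto)
  \<comment> \<open>One factor \<open>D\<close> is absorbed by \<open>Y\<close>, which accounts for
    the exponent j - 1 in the result. Keeping \<open>f\<close> arbitrary serves both cases.\<close>
  have umb: "umbral (f * D) (Ypoly n \<beta> k a b) =
      c * fact k * of_nat (n choose k) * (fact (n - k) * f $ (n - k))" for f
    by (simp add: umbral_Ypoly mult.assoc DY fact_mult_fps_X_power_nth flip: Y_def)
  \<comment> \<open>Both sides are exp(m b ln \<beta>) for the same value of the logarithm, so no
    branch issue arises.\<close>
  have pow: "\<beta> powr (of_real b * (of_nat j - 1)) = B ^ m"
    unfolding B_def j using \<open>\<beta> \<noteq> 0\<close>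
    by (simp add: powr_def mult_ac flip: exp_of_nat_mult)
  have "umbral (D ^ j) (Ypoly n \<beta> k a b) =
      c * fact k * of_nat (n choose k) * (fact (n - k) * D ^ m $ (n - k))"
    using umb [of "D ^ m"] by (simp only: j power_Suc2)
  also have "fact (n - k) * D ^ m $ (n - k) =
      B ^ m * (\<Sum>l=0..m. fact m / fact (m - l) * (1 - A / B) ^ (m - l) * of_nat (Stirling (n - k) l))"
    unfolding D_def by (subst fps_mult_exp_diff_power_nth [OF B]) simp
  finally have first: "umbral (D ^ j) (Ypoly n \<beta> k a b) =
      B ^ m * fact k / 2 powi (int k - 1) * of_nat (n choose k) *
      (\<Sum>l=0..m. fact m / fact (m - l) * (1 - A / B) ^ (m - l) * of_nat (Stirling (n - k) l))"
    by (simp add: c mult_ac)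
  have second: "umbral ((fps_exp 1 - 1) ^ j) (Ypoly n \<beta> k a b) =
      fact k * fact m / (2 powi (int k - 1) * A) * of_nat (n choose k) *
        of_nat (Stirling (n - k) m)" if "of_real a = \<beta>"
  proof -
    \<comment> \<open>On positive reals the principal complex power agrees with the real
      one.\<close>
    have "B = A"
      unfolding A_def B_def using that \<open>a > 0\<close> by (auto simp: powr_of_real)
    then have "fps_exp 1 - 1 = fps_const (1 / A) * D"
      unfolding D_def using A by (intro fps_ext) (simp add: field_simps)
    \<comment> \<open>Only one factor is rewritten through \<open>D\<close>, hence the single
      1/A.\<close>
    then have "(fps_exp 1 - 1) ^ j = fps_const (1 / A) * (fps_exp 1 - 1) ^ m * D"
      unfolding j by (metis mult.assoc mult.commute power_Suc)
    then show ?thesis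
      by (simp add: umb fps_exp_minus_one_power_nth c)
  qed
  show ?thesis
    using first second pow unfolding D_def A_def B_def j by auto
qed

end
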